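(* Let $\mathcal{H}$ be a complex Hilbert space, let $T\in\mathcal{B}(\mathcal{H})$ and let $q\in[0,1]$. Then $$\omega_q^2(T)\le q^2\,\omega^2(T)+\left(1-q^2+q\sqrt{1-q^2}\right)\|T\|^2 .$$
   Context: $\mathcal{B}(\mathcal{H})$ denotes the bounded linear operators on the complex Hilbert space $\mathcal{H}$ and $\|\cdot\|$ the operator norm. The numerical radius of $T$ is $\omega(T)=\sup\{|\langle Tx,x\rangle| : x\in\mathcal{H},\ \|x\|=1\}$. For $q\in[0,1]$, the $q$-numerical radius of $T$ is $\omega_q(T)=\sup\{|\langle Tx,y\rangle| : x,y\in\mathcal{H},\ \|x\|=\|y\|=1,\ \langle x,y\rangle=q\}$. Here $\omega^2(T)=(\omega(T))^2$ and $\omega_q^2(T)=(\omega_q(T))^2$. Suprema over empty sets (which occur only when $\dim\mathcal{H}=0$, or $\dim\mathcal{H}=1$ and $q<1$) are read as $0$. *)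

theory Defs
  imports "HOL-Analysis.Analysis"
begin

text \<open>
  Complex inner product spaces. The underlying real normed space supplies addition, norm and
  topology; the norm is tied to the inner product by \<open>norm_eq_sqrt_cinner\<close>. The inner product
  is linear in its first argument. The zero space is not excluded.
\<close>

class complex_inner = real_normed_vector +
  fixes scaleC :: "complex \<Rightarrow> 'a \<Rightarrow> 'a" (infixr "*\<^sub>C" 75)
    and cinner :: "'a \<Rightarrow> 'a \<Rightarrow> complex"
  assumes scaleC_add_right: "c *\<^sub>C (x + y) = c *\<^sub>C x + c *\<^sub>C y"
    and scaleC_add_left: "(c + d) *\<^sub>C x = c *\<^sub>C x + d *\<^sub>C x"
    and scaleC_scaleC: "c *\<^sub>C d *\<^sub>C x = (c * d) *\<^sub>C x"
    and scaleC_one: "1 *\<^sub>C x = x"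
    and scaleR_scaleC: "r *\<^sub>R x = complex_of_real r *\<^sub>C x"
    and cinner_commute: "cinner x y = cnj (cinner y x)"
    and cinner_add_left: "cinner (x + y) z = cinner x z + cinner y z"
    and cinner_scaleC_left: "cinner (c *\<^sub>C x) y = c * cinner x y"
    and cinner_ge_zero: "0 \<le> Re (cinner x x)"
    and cinner_eq_zero_iff: "cinner x x = 0 \<longleftrightarrow> x = 0"
    and norm_eq_sqrt_cinner: "norm x = sqrt (Re (cinner x x))"

class complex_hilbert = complex_inner + complete_space

definition bounded_clinear :: "('a::complex_inner \<Rightarrow> 'b::complex_inner) \<Rightarrow> bool" where
  "bounded_clinear T \<longleftrightarrow> bounded_linear T \<and> (\<forall>c x. T (c *\<^sub>C x) = c *\<^sub>C T x)"

text \<open>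
  The real-valued \<^const>\<open>Sup\<close> is unspecified on the empty set; here it is read as 0 there.
\<close>

definition Sup0 :: "real set \<Rightarrow> real" where
  "Sup0 S = (if S = {} then 0 else Sup S)"

definition numerical_radius :: "('a::complex_inner \<Rightarrow> 'a) \<Rightarrow> real" where
  "numerical_radius T = Sup0 {cmod (cinner (T x) x) | x. norm x = 1}"

definition q_numerical_radius :: "real \<Rightarrow> ('a::complex_inner \<Rightarrow> 'a) \<Rightarrow> real" where
  "q_numerical_radius q T =
     Sup0 {cmod (cinner (T x) y) | x y.
             norm x = 1 \<and> norm y = 1 \<and> cinner x y = complex_of_real q}"

end

theory Submission
  imports Defs
begin

text \<open>
  Let \<open>x\<close> and \<open>y\<close> be unit vectors with \<open>\<langle>x, y\<rangle> = q\<close>, and put \<open>s = sqrt (1 - q\<^sup>2)\<close>. Split both \<open>y\<close>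
  and \<open>T x\<close> into a multiple of \<open>x\<close> and a part orthogonal to \<open>x\<close>: \<open>y = q x + v\<close> with \<open>\<parallel>v\<parallel> = s\<close>, and
  \<open>T x = \<langle>T x, x\<rangle> x + w\<close>, where \<open>a = |\<langle>T x, x\<rangle>|\<close> and \<open>d = \<parallel>w\<parallel>\<close> satisfy
  \<open>a\<^sup>2 + d\<^sup>2 = \<parallel>T x\<parallel>\<^sup>2 \<le> \<parallel>T\<parallel>\<^sup>2\<close> by Pythagoras. The mixed terms vanish, so Cauchy--Schwarz gives
  \<open>|\<langle>T x, y\<rangle>| \<le> q a + s d\<close>. When this is squared, the cross term \<open>2 q s a d\<close> is at most
  \<open>q s (a\<^sup>2 + d\<^sup>2) \<le> q s \<parallel>T\<parallel>\<^sup>2\<close>, the term \<open>s\<^sup>2 d\<^sup>2\<close> is at most \<open>(1 - q\<^sup>2) \<parallel>T\<parallel>\<^sup>2\<close>, and \<open>q\<^sup>2 a\<^sup>2\<close> is at most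
  \<open>q\<^sup>2 \<omega>\<^sup>2(T)\<close>. The bound does not depend on \<open>x\<close> and \<open>y\<close>, so it passes to the supremum.
\<close>

lemma cinner_add_right: "cinner x (y + z) = cinner x y + cinner x z"
  by (metis cinner_add_left cinner_commute complex_cnj_add)

lemma cinner_scaleC_right: "cinner x (c *\<^sub>C y) = cnj c * cinner x y"
  by (metis cinner_scaleC_left cinner_commute complex_cnj_mult)

lemma cinner_diff_left: "cinner (x - y) z = cinner x z - cinner y z"
  using cinner_add_left[of "x - y" y z] by simp

lemma cinner_diff_right: "cinner x (y - z) = cinner x y - cinner x z"
  using cinner_add_right[of x "y - z" z] by simp

lemma cinner_zero_right: "cinner x 0 = 0"
  using cinner_add_right[of x 0 0] by simp

lemma Re_cinner_self: "Re (cinner x x) = (norm x)\<^sup>2"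
  using norm_eq_sqrt_cinner[of x] cinner_ge_zero[of x] by simp

lemma cinner_self: "cinner x x = complex_of_real ((norm x)\<^sup>2)"
proof -
  have "Im (cinner x x) = 0"
    using arg_cong[OF cinner_commute[of x x], of Im] by simp
  then show ?thesis
    by (simp add: complex_eq_iff Re_cinner_self)
qed

lemma norm_diff_scaleC_squared:
  "(norm (x - c *\<^sub>C y))\<^sup>2
     = (norm x)\<^sup>2 - 2 * Re (cnj c * cinner x y) + (cmod c)\<^sup>2 * (norm y)\<^sup>2"
proof -
  have "Re (c * cinner y x) = Re (cnj c * cinner x y)"
    by (subst cinner_commute) simp
  moreover have "Re (c * (cnj c * cinner y y)) = (cmod c)\<^sup>2 * (norm y)\<^sup>2"
    unfolding cmod_power2 by (simp add: cinner_self algebra_simps power2_eq_square)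
  moreover have "cinner (x - c *\<^sub>C y) (x - c *\<^sub>C y)
      = cinner x x - cnj c * cinner x y - c * cinner y x + c * (cnj c * cinner y y)"
    by (simp add: cinner_diff_left cinner_diff_right cinner_scaleC_left cinner_scaleC_right
        algebra_simps)
  then have "Re (cinner (x - c *\<^sub>C y) (x - c *\<^sub>C y))
      = Re (cinner x x) - Re (cnj c * cinner x y) - Re (c * cinner y x)
        + Re (c * (cnj c * cinner y y))"
    by (simp only: plus_complex.sel minus_complex.sel)
  ultimately show ?thesis
    unfolding Re_cinner_self by linarith
qed

lemma norm_diff_projection_squared:
  assumes "norm y = 1"
  shows "(norm (x - cinner x y *\<^sub>C y))\<^sup>2 = (norm x)\<^sup>2 - (cmod (cinner x y))\<^sup>2"
proof -
  have "Re (cnj (cinner x y) * cinner x y) = (cmod (cinner x y))\<^sup>2"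
    unfolding cmod_power2 by (simp add: power2_eq_square)
  then show ?thesis
    by (simp add: norm_diff_scaleC_squared assms)
qed

text \<open>
  The Pythagorean identity makes the Cauchy--Schwarz defect the squared norm of a projection once
  \<open>y\<close> is normalised.
\<close>

lemma cmod_cinner_le: "cmod (cinner x y) \<le> norm x * norm y"
proof (cases "y = 0")
  case True
  then show ?thesis by (simp add: cinner_zero_right)
next
  case False
  define u where "u = complex_of_real (1 / norm y) *\<^sub>C y"
  have "u = (1 / norm y) *\<^sub>R y"
    unfolding u_def by (simp add: scaleR_scaleC)
  then have "norm u = 1"
    using False by simp
  then have "(cmod (cinner x u))\<^sup>2 \<le> (norm x)\<^sup>2"
    using norm_diff_projection_squared[of u x] zero_le_power2[of "norm (x - cinner x u *\<^sub>C u)"]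
    by linarith
  then have "cmod (cinner x u) \<le> norm x"
    by (rule power2_le_imp_le) simp
  moreover have "cmod (cinner x u) = cmod (cinner x y) / norm y"
    unfolding u_def by (simp add: cinner_scaleC_right norm_mult norm_divide)
  ultimately show ?thesis
    using False by (simp add: divide_le_eq)
qed

text \<open>
  This is the orthogonal splitting along \<open>x\<close>. It keeps the component of \<open>y\<close> orthogonal to \<open>x\<close>
  unnormalised, so that \<open>q = 1\<close>, where this component is zero, needs no separate treatment.
\<close>

lemma cmod_cinner_le_along_unit_vector:
  assumes x: "norm x = 1" and y: "norm y = 1"
    and xy: "cinner x y = complex_of_real q" and q: "0 \<le> q"
  shows "cmod (cinner u y)
    \<le> q * cmod (cinner u x) + sqrt (1 - q\<^sup>2) * norm (u - cinner u x *\<^sub>C x)"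
proof -
  define v where "v = y - complex_of_real q *\<^sub>C x"
  define w where "w = u - cinner u x *\<^sub>C x"
  have yx: "cinner y x = complex_of_real q"
    by (subst cinner_commute) (simp add: xy)
  have "(norm v)\<^sup>2 = 1 - q\<^sup>2"
    using norm_diff_projection_squared[OF x, of y] by (simp add: v_def yx y)
  then have norm_v: "norm v = sqrt (1 - q\<^sup>2)"
    by (simp add: real_sqrt_unique)
  have "cinner x v = 0"
    by (simp add: v_def cinner_diff_right cinner_scaleC_right xy cinner_self x)
  then have "cinner u v = cinner w v"
    by (simp add: w_def cinner_diff_left cinner_scaleC_left)
  moreover have "cinner u y = complex_of_real q * cinner u x + cinner u v"
    by (simp add: v_def cinner_diff_right cinner_scaleC_right)
  ultimately have "cmod (cinner u y)
      \<le> cmod (complex_of_real q * cinner u x) + cmod (cinner w v)"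
    by (simp add: norm_triangle_ineq)
  also have "\<dots> \<le> q * cmod (cinner u x) + norm w * norm v"
    using cmod_cinner_le[of w v] q by (simp add: norm_mult)
  finally show ?thesis
    by (simp add: norm_v w_def mult.commute)
qed

lemma square_sum_le_of_pythagoras:
  fixes q s a d N :: real
  assumes "0 \<le> q" "0 \<le> s" and "a\<^sup>2 + d\<^sup>2 \<le> N\<^sup>2"
  shows "(q * a + s * d)\<^sup>2 \<le> q\<^sup>2 * a\<^sup>2 + (s\<^sup>2 + q * s) * N\<^sup>2"
proof -
  have "2 * a * d \<le> N\<^sup>2"
    using sum_squares_bound[of a d] assms(3) by linarith
  then have "(q * s) * (2 * a * d) \<le> (q * s) * N\<^sup>2"
    using assms by (intro mult_left_mono) auto
  moreover have "d\<^sup>2 \<le> N\<^sup>2"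
    using assms(3) zero_le_power2[of a] by linarith
  then have "s\<^sup>2 * d\<^sup>2 \<le> s\<^sup>2 * N\<^sup>2"
    by (intro mult_left_mono) auto
  ultimately show ?thesis
    by (simp add: power2_sum power_mult_distrib algebra_simps)
qed

lemma cmod_cinner_le_numerical_radius:
  assumes "bounded_linear T" and "norm x = 1"
  shows "cmod (cinner (T x) x) \<le> numerical_radius T"
proof -
  let ?S = "{cmod (cinner (T x) x) | x. norm x = 1}"
  have "bdd_above ?S"
  proof (rule bdd_aboveI)
    fix r assume "r \<in> ?S"
    then obtain z where "r = cmod (cinner (T z) z)" "norm z = 1"
      by blast
    then show "r \<le> onorm T"
      using cmod_cinner_le[of "T z" z] onorm[OF assms(1), of z] by simp
  qed
  moreover have "cmod (cinner (T x) x) \<in> ?S"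
    using assms(2) by blast
  ultimately show ?thesis
    unfolding numerical_radius_def Sup0_def by (auto intro: cSup_upper)
qed

lemma Sup0_squared_le:
  assumes nonneg: "\<And>r. r \<in> S \<Longrightarrow> 0 \<le> r" and bound: "\<And>r. r \<in> S \<Longrightarrow> r\<^sup>2 \<le> B"
    and "0 \<le> B"
  shows "(Sup0 S)\<^sup>2 \<le> B"
proof (cases "S = {}")
  case True
  then show ?thesis using \<open>0 \<le> B\<close> by (simp add: Sup0_def)
next
  case False
  then obtain r where r: "r \<in> S" by blast
  have le: "t \<le> sqrt B" if "t \<in> S" for t
    using bound[OF that] by (rule real_le_rsqrt)
  have "0 \<le> Sup S"
    using nonneg[OF r] cSup_upper[OF r bdd_aboveI[OF le]] by linarith
  moreover have "Sup S \<le> sqrt B"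
    using False le by (rule cSup_least)
  ultimately have "(Sup S)\<^sup>2 \<le> (sqrt B)\<^sup>2"
    by (intro power_mono)
  then show ?thesis
    using False \<open>0 \<le> B\<close> by (simp add: Sup0_def)
qed

theorem theorem2p6:
  fixes T :: "'a::complex_hilbert \<Rightarrow> 'a" and q :: real
  assumes "bounded_clinear T" and "q \<in> {0..1}"
  shows "(q_numerical_radius q T)\<^sup>2
    \<le> q\<^sup>2 * (numerical_radius T)\<^sup>2 + (1 - q\<^sup>2 + q * sqrt (1 - q\<^sup>2)) * (onorm T)\<^sup>2"
    (is "_ \<le> ?B")
proof -
  define s where "s = sqrt (1 - q\<^sup>2)"
  have T: "bounded_linear T"
    using assms(1) by (simp add: bounded_clinear_def)
  have q: "0 \<le> q" "q\<^sup>2 \<le> 1"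
    using assms(2) by (auto simp: power_le_one)
  have s: "0 \<le> s" "s\<^sup>2 = 1 - q\<^sup>2"
    using q by (simp_all add: s_def)
  have bound: "(cmod (cinner (T x) y))\<^sup>2 \<le> ?B"
    if x: "norm x = 1" and y: "norm y = 1" and xy: "cinner x y = complex_of_real q" for x y
  proof -
    define a where "a = cmod (cinner (T x) x)"
    define d where "d = norm (T x - cinner (T x) x *\<^sub>C x)"
    have "norm (T x) \<le> onorm T"
      using onorm[OF T, of x] x by simp
    then have "(norm (T x))\<^sup>2 \<le> (onorm T)\<^sup>2"
      by (intro power_mono) auto
    then have ad: "a\<^sup>2 + d\<^sup>2 \<le> (onorm T)\<^sup>2"
      using norm_diff_projection_squared[OF x, of "T x"] by (simp add: a_def d_def)
    have "cmod (cinner (T x) y) \<le> q * a + s * d"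
      using cmod_cinner_le_along_unit_vector[OF x y xy q(1), of "T x"]
      by (simp add: a_def d_def s_def)
    then have "(cmod (cinner (T x) y))\<^sup>2 \<le> (q * a + s * d)\<^sup>2"
      by (intro power_mono) auto
    also have "\<dots> \<le> q\<^sup>2 * a\<^sup>2 + (s\<^sup>2 + q * s) * (onorm T)\<^sup>2"
      using q(1) s(1) ad by (rule square_sum_le_of_pythagoras)
    also have "a\<^sup>2 \<le> (numerical_radius T)\<^sup>2"
      unfolding a_def using cmod_cinner_le_numerical_radius[OF T x] by (intro power_mono) auto
    then have "q\<^sup>2 * a\<^sup>2 + (s\<^sup>2 + q * s) * (onorm T)\<^sup>2
        \<le> q\<^sup>2 * (numerical_radius T)\<^sup>2 + (s\<^sup>2 + q * s) * (onorm T)\<^sup>2"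
      by (intro add_right_mono mult_left_mono) auto
    finally show ?thesis
      by (simp add: s(2)) (simp add: s_def)
  qed
  have "0 \<le> ?B"
    using q s(1) unfolding s_def by (intro add_nonneg_nonneg mult_nonneg_nonneg) auto
  then show ?thesis
    unfolding q_numerical_radius_def using bound by (intro Sup0_squared_le) auto
qed

end
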